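(* Let $\ddot{\mathbb A}$ be a relational BiKAT over a relational KAT $\mathbb A$ on a set $\Sigma$. Let $c,d\in\mathbb A$ and let $R,S$ be relations on $\Sigma$ such that the sub-identities $\dot R,\dot S$ are tests of $\ddot{\mathbb A}$. Then (a) $\forall\sigma,\sigma',\tau,\tau'.\ (\sigma R\sigma'\wedge \sigma\, c\,\tau\wedge \sigma'\, d\,\tau')\Rightarrow \tau S\tau'$ holds if and only if $\dot R;\langle c\mid d\rangle;\neg\dot S=0$; (b) for any $B\in\ddot{\mathbb A}$, if $\dot R;\langle c\mid d\rangle\le \dot R;B$ and $\dot R;B;\neg \dot S=0$, then $\forall\sigma,\sigma',\tau,\tau'.\ (\sigma R\sigma'\wedge \sigma\, c\,\tau\wedge \sigma'\, d\,\tau')\Rightarrow \tau S\tau'$.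
   Context: A relational KAT on a set $\Sigma$ is a KAT whose actions $\mathbb A$ are relations on $\Sigma$ and whose tests are sub-identities (subsets of the identity $id_\Sigma$), with $1=id_\Sigma$, $0=\emptyset$, $;$ relational composition, $+$ union, ${}^*$ reflexive-transitive closure, $\neg p = id_\Sigma\setminus p$, and $\le$ inclusion ($\mathbb A$ closed under these, but need not contain all relations). For relations $R,S$ on $\Sigma$, $R\otimes S$ is the relation on $\Sigma\times\Sigma$ with $(\sigma,\sigma')(R\otimes S)(\tau,\tau')$ iff $\sigma R\tau$ and $\sigma' S\tau'$. A relational BiKAT over a relational KAT $\mathbb A$ on $\Sigma$ is a relational KAT $\ddot{\mathbb A}$ on $\Sigma\times\Sigma$ containing $\langle R] := R\otimes id_\Sigma$ and $[R\rangle := id_\Sigma\otimes R$ for all $R\in\mathbb A$, and such that the projections $\swarrow\mathcal R=\{(\sigma,\tau):\exists\sigma',\tau'.\,(\sigma,\sigma')\mathcal R(\tau,\tau')\}$ and $\searrow\mathcal R=\{(\sigma',\tau'):\exists\sigma,\tau.\,(\sigma,\sigma')\mathcal R(\tau,\tau')\}$ lie in $\mathbb A$ for all $\mathcal R\in\ddot{\mathbb A}$. $\langle c\mid d\rangle := \langle c];[d\rangle = c\otimes d$. For a relation $R$ on $\Sigma$, $\dot R$ is the sub-identity on $\Sigma\times\Sigma$ relating $(\sigma,\sigma')$ to itself iff $\sigma R\sigma'$. *)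

theory Defs
  imports Main
begin

text \<open>
  The base set \<open>\<Sigma>\<close> is an arbitrary carrier set and need not exhaust its type. Hence the
  unit is \<^term>\<open>Id_on \<Sigma>\<close> rather than \<^term>\<open>Id\<close>, and the reflexive-transitive closure and the
  negation of tests are taken relative to \<open>\<Sigma>\<close>.
\<close>

definition star_on :: "'a set \<Rightarrow> 'a rel \<Rightarrow> 'a rel" where
  "star_on \<Sigma> R = R\<^sup>* \<inter> (\<Sigma> \<times> \<Sigma>)"

definition neg_on :: "'a set \<Rightarrow> 'a rel \<Rightarrow> 'a rel" where
  "neg_on \<Sigma> p = Id_on \<Sigma> - p"

text \<open>
  The equational axioms of Kleene algebra with tests hold for all relations and sub-identities
  on \<open>\<Sigma>\<close>, so a relational KAT is given by a set of actions and a set of tests having the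
  required closure properties. Not every sub-identity among the actions has to be a test.
\<close>

locale relational_kat =
  fixes \<Sigma> :: "'a set"
    and actions :: "'a rel set"
    and tests :: "'a rel set"
  assumes action_rel: "R \<in> actions \<Longrightarrow> R \<subseteq> \<Sigma> \<times> \<Sigma>"
    and test_action: "p \<in> tests \<Longrightarrow> p \<in> actions"
    and test_subid: "p \<in> tests \<Longrightarrow> p \<subseteq> Id_on \<Sigma>"
    and one_test: "Id_on \<Sigma> \<in> tests"
    and zero_test: "{} \<in> tests"
    and comp_action: "\<lbrakk>R \<in> actions; S \<in> actions\<rbrakk> \<Longrightarrow> R O S \<in> actions"
    and plus_action: "\<lbrakk>R \<in> actions; S \<in> actions\<rbrakk> \<Longrightarrow> R \<union> S \<in> actions"
    and star_action: "R \<in> actions \<Longrightarrow> star_on \<Sigma> R \<in> actions"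
    and comp_test: "\<lbrakk>p \<in> tests; q \<in> tests\<rbrakk> \<Longrightarrow> p O q \<in> tests"
    and plus_test: "\<lbrakk>p \<in> tests; q \<in> tests\<rbrakk> \<Longrightarrow> p \<union> q \<in> tests"
    and neg_test: "p \<in> tests \<Longrightarrow> neg_on \<Sigma> p \<in> tests"

definition rel_tensor :: "'a rel \<Rightarrow> 'a rel \<Rightarrow> ('a \<times> 'a) rel" (infixr "\<otimes>" 75) where
  "R \<otimes> S = {((\<sigma>, \<sigma>'), (\<tau>, \<tau>')) | \<sigma> \<sigma>' \<tau> \<tau>'. (\<sigma>, \<tau>) \<in> R \<and> (\<sigma>', \<tau>') \<in> S}"

definition left_emb :: "'a set \<Rightarrow> 'a rel \<Rightarrow> ('a \<times> 'a) rel" where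
  "left_emb \<Sigma> R = R \<otimes> Id_on \<Sigma>"

definition right_emb :: "'a set \<Rightarrow> 'a rel \<Rightarrow> ('a \<times> 'a) rel" where
  "right_emb \<Sigma> R = Id_on \<Sigma> \<otimes> R"

definition left_proj :: "('a \<times> 'a) rel \<Rightarrow> 'a rel" where
  "left_proj Q = {(\<sigma>, \<tau>). \<exists>\<sigma>' \<tau>'. ((\<sigma>, \<sigma>'), (\<tau>, \<tau>')) \<in> Q}"

definition right_proj :: "('a \<times> 'a) rel \<Rightarrow> 'a rel" where
  "right_proj Q = {(\<sigma>', \<tau>'). \<exists>\<sigma> \<tau>. ((\<sigma>, \<sigma>'), (\<tau>, \<tau>')) \<in> Q}"

definition emb_pair :: "'a set \<Rightarrow> 'a rel \<Rightarrow> 'a rel \<Rightarrow> ('a \<times> 'a) rel" where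
  "emb_pair \<Sigma> c d = left_emb \<Sigma> c O right_emb \<Sigma> d"

definition dot :: "'a rel \<Rightarrow> ('a \<times> 'a) rel" where
  "dot R = {((\<sigma>, \<sigma>'), (\<sigma>, \<sigma>')) | \<sigma> \<sigma>'. (\<sigma>, \<sigma>') \<in> R}"

locale relational_bikat =
  base: relational_kat \<Sigma> actions tests +
  bi: relational_kat "\<Sigma> \<times> \<Sigma>" biactions bitests
  for \<Sigma> :: "'a set"
    and actions :: "'a rel set"
    and tests :: "'a rel set"
    and biactions :: "('a \<times> 'a) rel set"
    and bitests :: "('a \<times> 'a) rel set" +
  assumes left_emb_action: "R \<in> actions \<Longrightarrow> left_emb \<Sigma> R \<in> biactions"
    and right_emb_action: "R \<in> actions \<Longrightarrow> right_emb \<Sigma> R \<in> biactions"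
    and left_proj_action: "Q \<in> biactions \<Longrightarrow> left_proj Q \<in> actions"
    and right_proj_action: "Q \<in> biactions \<Longrightarrow> right_proj Q \<in> actions"

lemma emb_pair_eq_tensor:
  assumes "c \<subseteq> \<Sigma> \<times> \<Sigma>" and "d \<subseteq> \<Sigma> \<times> \<Sigma>"
  shows "emb_pair \<Sigma> c d = c \<otimes> d"
  using assms by (fastforce simp: emb_pair_def left_emb_def right_emb_def rel_tensor_def)

end

theory Submission
  imports Defs
begin

text \<open>The tests \<open>dot R\<close> and
  \<open>neg_on (\<Sigma> \<times> \<Sigma>) (dot S)\<close> only filter the start and end of a
  paired run of \<open>c\<close> and \<open>d\<close>. An element of the composite is thus exactly a
  counterexample to the relational judgment: a run that starts in \<open>R\<close> and ends outside
  \<open>S\<close>. Emptiness means that there is none, which is (a); this is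
  \<open>dot_tensor_neg_empty_iff\<close>, transferred to \<open>emb_pair\<close> by
  \<open>emb_pair_eq_tensor\<close>. For (b), monotonicity of composition puts the composite for
  \<open>emb_pair \<Sigma> c d\<close> inside the empty one for \<open>B\<close>, and (a)
  applies.\<close>

lemma dot_tensor_neg_empty_iff:
  assumes "c \<subseteq> \<Sigma> \<times> \<Sigma>" and "d \<subseteq> \<Sigma> \<times> \<Sigma>"
  shows "dot R O (c \<otimes> d) O neg_on (\<Sigma> \<times> \<Sigma>) (dot S) = {} \<longleftrightarrow>
    (\<forall>\<sigma> \<sigma>' \<tau> \<tau>'. (\<sigma>, \<sigma>') \<in> R \<and> (\<sigma>, \<tau>) \<in> c \<and> (\<sigma>', \<tau>') \<in> d \<longrightarrow> (\<tau>, \<tau>') \<in> S)"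
    (is "?E \<longleftrightarrow> ?V")
proof
  assume E: ?E
  show ?V
  proof (intro allI impI, rule ccontr)
    fix \<sigma> \<sigma>' \<tau> \<tau>'
    assume *: "(\<sigma>, \<sigma>') \<in> R \<and> (\<sigma>, \<tau>) \<in> c \<and> (\<sigma>', \<tau>') \<in> d" and "(\<tau>, \<tau>') \<notin> S"
    \<comment> \<open>Negation is relative to \<Sigma> \<times> \<Sigma>, so not being in
      \<open>S\<close> is not enough: the end states must lie in \<Sigma>, which the bounds on
      \<open>c\<close> and \<open>d\<close> ensure.\<close>
    then have "((\<tau>, \<tau>'), (\<tau>, \<tau>')) \<in> neg_on (\<Sigma> \<times> \<Sigma>) (dot S)"
      using assms by (auto simp: neg_on_def dot_def)
    moreover have "((\<sigma>, \<sigma>'), (\<sigma>, \<sigma>')) \<in> dot R" and "((\<sigma>, \<sigma>'), (\<tau>, \<tau>')) \<in> c \<otimes> d"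
      using * by (auto simp: dot_def rel_tensor_def)
    ultimately have "((\<sigma>, \<sigma>'), (\<tau>, \<tau>')) \<in> dot R O (c \<otimes> d) O neg_on (\<Sigma> \<times> \<Sigma>) (dot S)"
      by blast
    with E show False by simp
  qed
next
  assume ?V
  \<comment> \<open>Both outer factors are sub-identities, so the intermediate states of a composite
    pair are its own endpoints.\<close>
  then show ?E
    by (fastforce simp: dot_def rel_tensor_def neg_on_def)
qed

theorem theorem4p6:
  fixes \<Sigma> :: "'a set"
    and actions tests :: "'a rel set"
    and biactions bitests :: "('a \<times> 'a) rel set"
    and c d R S :: "'a rel"
  assumes "relational_bikat \<Sigma> actions tests biactions bitests"
    and "c \<in> actions" and "d \<in> actions"
    and "R \<subseteq> \<Sigma> \<times> \<Sigma>" and "S \<subseteq> \<Sigma> \<times> \<Sigma>"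
    and "dot R \<in> bitests" and "dot S \<in> bitests"
  shows "((\<forall>\<sigma>\<in>\<Sigma>. \<forall>\<sigma>'\<in>\<Sigma>. \<forall>\<tau>\<in>\<Sigma>. \<forall>\<tau>'\<in>\<Sigma>.
             (\<sigma>, \<sigma>') \<in> R \<and> (\<sigma>, \<tau>) \<in> c \<and> (\<sigma>', \<tau>') \<in> d \<longrightarrow> (\<tau>, \<tau>') \<in> S)
           \<longleftrightarrow> dot R O emb_pair \<Sigma> c d O neg_on (\<Sigma> \<times> \<Sigma>) (dot S) = {})
       \<and> (\<forall>B\<in>biactions.
            dot R O emb_pair \<Sigma> c d \<subseteq> dot R O B
            \<and> dot R O B O neg_on (\<Sigma> \<times> \<Sigma>) (dot S) = {}
            \<longrightarrow> (\<forall>\<sigma>\<in>\<Sigma>. \<forall>\<sigma>'\<in>\<Sigma>. \<forall>\<tau>\<in>\<Sigma>. \<forall>\<tau>'\<in>\<Sigma>.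
                   (\<sigma>, \<sigma>') \<in> R \<and> (\<sigma>, \<tau>) \<in> c \<and> (\<sigma>', \<tau>') \<in> d \<longrightarrow> (\<tau>, \<tau>') \<in> S))"
proof -
  interpret relational_bikat \<Sigma> actions tests biactions bitests
    by fact
  have cd: "c \<subseteq> \<Sigma> \<times> \<Sigma>" "d \<subseteq> \<Sigma> \<times> \<Sigma>"
    using assms base.action_rel by auto
  let ?N = "neg_on (\<Sigma> \<times> \<Sigma>) (dot S)"
  let ?V = "\<forall>\<sigma>\<in>\<Sigma>. \<forall>\<sigma>'\<in>\<Sigma>. \<forall>\<tau>\<in>\<Sigma>. \<forall>\<tau>'\<in>\<Sigma>.
    (\<sigma>, \<sigma>') \<in> R \<and> (\<sigma>, \<tau>) \<in> c \<and> (\<sigma>', \<tau>') \<in> d \<longrightarrow> (\<tau>, \<tau>') \<in> S"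
  have a: "?V \<longleftrightarrow> dot R O emb_pair \<Sigma> c d O ?N = {}"
    \<comment> \<open>The lemma quantifies over the whole type, \<open>?V\<close> over \<Sigma>;
      they agree because \<open>c\<close> and \<open>d\<close> relate only states of
      \<Sigma>.\<close>
    unfolding emb_pair_eq_tensor[OF cd] dot_tensor_neg_empty_iff[OF cd] using cd by blast
  moreover have ?V
    if "dot R O emb_pair \<Sigma> c d \<subseteq> dot R O B" and "dot R O B O ?N = {}" for B
  proof -
    have "(dot R O emb_pair \<Sigma> c d) O ?N \<subseteq> (dot R O B) O ?N"
      using that(1) by (rule relcomp_mono) simp
    with that(2) show ?V
      \<comment> \<open>By \<open>a\<close> the goal becomes emptiness of a composite, and the
        inclusion above, rebracketed, bounds that composite by the empty relation.\<close>
      unfolding a by (simp add: O_assoc)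
  qed
  ultimately show ?thesis
    by blast
qed

end
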